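(* Let $a,b\in\mathbb C$ and let $\mathcal U,\mathcal V$ be the generators of a unital associative complex algebra satisfying the commutation relation $[\mathcal V,\mathcal U]=a\mathcal V+b$. Then, for each $n\in\mathbb N$, $$(\mathcal U\mathcal V)^n=\sum_{k=1}^nb^{n-k}S(n,k)\,\mathcal U(\mathcal U+a)(\mathcal U+2a)\cdots(\mathcal U+(k-1)a)\,\mathcal V^k=\sum_{k=1}^nb^{n-k}S(n,k)\,(\mathcal U\mid-a)_k\,\mathcal V^k.$$
   Context: $[\mathcal V,\mathcal U]=\mathcal V\mathcal U-\mathcal U\mathcal V$. $S(n,k)$ are the Stirling numbers of the second kind: $z^n=\sum_{k=1}^nS(n,k)\,z(z-1)\cdots(z-k+1)$. $(\mathcal U\mid-a)_k=\mathcal U(\mathcal U+a)\cdots(\mathcal U+(k-1)a)$. The algebra considered is the complex free algebra in two generators $\mathcal U,\mathcal V$ subject to the stated relation (a generalized Weyl algebra); scalars are identified with multiples of the unit. Convention $0^0=1$. *)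

theory Defs
  imports Complex_Main "HOL-Algebra.Module" "HOL-Combinatorics.Stirling"
begin

definition complex_ring :: "complex ring" where
  "complex_ring = \<lparr>carrier = UNIV, mult = (*), one = 1, zero = 0, add = (+)\<rparr>"

text \<open>
  The library locale \<^locale>\<open>algebra\<close> covers commutative algebras only. Here multiplication
  need not commute, so scalars have to be required to pass through both factors of a product.
\<close>

locale complex_algebra = module complex_ring A + ring A for A (structure) +
  assumes smult_mult_left:
      "\<lbrakk>x \<in> carrier A; y \<in> carrier A\<rbrakk> \<Longrightarrow> (c \<odot> x) \<otimes> y = c \<odot> (x \<otimes> y)"
    and smult_mult_right:
      "\<lbrakk>x \<in> carrier A; y \<in> carrier A\<rbrakk> \<Longrightarrow> x \<otimes> (c \<odot> y) = c \<odot> (x \<otimes> y)"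

text \<open>Ordered product \<open>f 0 \<otimes> f 1 \<otimes> \<dots> \<otimes> f (k - 1)\<close>, equal to \<open>\<one>\<close> for \<open>k = 0\<close>.\<close>

definition ordered_prod :: "('a, 'm) ring_scheme \<Rightarrow> (nat \<Rightarrow> 'a) \<Rightarrow> nat \<Rightarrow> 'a" where
  "ordered_prod A f k = foldr (mult A) (map f [0..<k]) (one A)"

text \<open>
  \<open>gen_factorial A x s k\<close> is \<open>(x | s)\<^sub>k = x (x - s) \<dots> (x - (k - 1) s)\<close>. The step \<open>s\<close> enters with
  a minus sign, so \<open>(x | -a)\<^sub>k = x (x + a) \<dots> (x + (k - 1) a)\<close>.
\<close>

primrec gen_factorial :: "(complex, 'a) module \<Rightarrow> 'a \<Rightarrow> complex \<Rightarrow> nat \<Rightarrow> 'a" where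
  "gen_factorial A x s 0 = \<one>\<^bsub>A\<^esub>"
| "gen_factorial A x s (Suc k) =
     gen_factorial A x s k \<otimes>\<^bsub>A\<^esub> (x \<ominus>\<^bsub>A\<^esub> (of_nat k * s) \<odot>\<^bsub>A\<^esub> \<one>\<^bsub>A\<^esub>)"

text \<open>
  The library defines \<^const>\<open>Stirling\<close> by its recurrence. Expanding powers in falling factorials
  identifies these values with the Stirling numbers of the second kind.
\<close>

lemma power_eq_sum_Stirling:
  fixes z :: complex
  assumes "n \<ge> 1"
  shows "z ^ n = (\<Sum>k=1..n. of_nat (Stirling n k) * (\<Prod>i<k. z - of_nat i))"
proof -
  have main: "z ^ m = (\<Sum>k\<le>m. of_nat (Stirling m k) * (\<Prod>i<k. z - of_nat i))" for m
  proof (induction m)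
    case 0
    show ?case by simp
  next
    case (Suc m)
    let ?p = "\<lambda>k. \<Prod>i<k. z - of_nat i"
    let ?S = "\<lambda>k. of_nat (Stirling m k) :: complex"
    have "z ^ Suc m = (\<Sum>k\<le>m. ?S k * (z * ?p k))"
      using Suc by (simp add: sum_distrib_left mult_ac)
    also have "\<dots> = (\<Sum>k\<le>m. ?S k * ?p (Suc k) + of_nat k * ?S k * ?p k)"
      by (intro sum.cong) (simp_all add: algebra_simps)
    also have "\<dots> = (\<Sum>k\<le>m. ?S k * ?p (Suc k)) + (\<Sum>k\<le>m. of_nat k * ?S k * ?p k)"
      by (rule sum.distrib)
    also have "(\<Sum>k\<le>m. of_nat k * ?S k * ?p k) = (\<Sum>k\<le>Suc m. of_nat k * ?S k * ?p k)"
      by simp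
    also have "\<dots> = (\<Sum>k\<le>m. of_nat (Suc k) * ?S (Suc k) * ?p (Suc k))"
      by (subst sum.atMost_Suc_shift) simp
    also have "(\<Sum>k\<le>m. ?S k * ?p (Suc k)) + \<dots> =
        (\<Sum>k\<le>m. of_nat (Stirling (Suc m) (Suc k)) * ?p (Suc k))"
      unfolding sum.distrib[symmetric]
      by (intro sum.cong refl) (simp add: algebra_simps del: prod.lessThan_Suc)
    also have "\<dots> = (\<Sum>k\<le>Suc m. of_nat (Stirling (Suc m) k) * ?p k)"
      by (subst sum.atMost_Suc_shift) simp
    finally show ?case .
  qed
  obtain m where m: "n = Suc m"
    using assms by (cases n) auto
  have "z ^ n = (\<Sum>k=0..n. of_nat (Stirling n k) * (\<Prod>i<k. z - of_nat i))"
    using main[of n] by (simp add: atMost_atLeast0)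
  also have "\<dots> = (\<Sum>k=1..n. of_nat (Stirling n k) * (\<Prod>i<k. z - of_nat i))"
    by (subst sum.atLeast_Suc_atMost) (simp_all add: m)
  finally show ?thesis .
qed

end

theory Submission
  imports Defs
begin

text \<open>
  With \<open>P\<^sub>k = U (U + a) \<dots> (U + (k - 1) a)\<close>, the commutation relation gives
  \<open>V\<^sup>k U = (U + k a) V\<^sup>k + k b V\<^sup>k\<^sup>-\<^sup>1\<close>. Hence \<open>T\<^sub>k = P\<^sub>k V\<^sup>k\<close> satisfies
  \<open>T\<^sub>k U V = T\<^sub>k\<^sub>+\<^sub>1 + k b T\<^sub>k\<close>, and the coefficients of \<open>(U V)\<^sup>n\<close> in the \<open>T\<^sub>k\<close> therefore
  follow the Stirling recurrence, weighted by powers of \<open>b\<close>.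
\<close>

context complex_algebra
begin

text \<open>The module axioms are phrased through the record \<open>complex_ring\<close>. From here
  on, scalars are handled by ordinary complex arithmetic.\<close>

lemma smult_complex_closed [simp, intro]:
  "x \<in> carrier A \<Longrightarrow> c \<odot> x \<in> carrier A"
  using smult_closed[of c x] by (simp add: complex_ring_def)

lemma smult_complex_add:
  "x \<in> carrier A \<Longrightarrow> (c + d) \<odot> x = c \<odot> x \<oplus> d \<odot> x"
  using smult_l_distr[of c d x] by (simp add: complex_ring_def)

lemma smult_complex_add_right:
  "\<lbrakk>x \<in> carrier A; y \<in> carrier A\<rbrakk> \<Longrightarrow> c \<odot> (x \<oplus> y) = c \<odot> x \<oplus> c \<odot> y"
  using smult_r_distr[of c x y] by (simp add: complex_ring_def)

lemma smult_complex_mult: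
  "x \<in> carrier A \<Longrightarrow> (c * d) \<odot> x = c \<odot> (d \<odot> x)"
  using smult_assoc1[of c d x] by (simp add: complex_ring_def)

lemma smult_complex_one [simp]: "x \<in> carrier A \<Longrightarrow> 1 \<odot> x = x"
  using smult_one[of x] by (simp add: complex_ring_def)

lemma smult_complex_zero [simp]: "x \<in> carrier A \<Longrightarrow> 0 \<odot> x = \<zero>"
  using smult_l_null[of x] by (simp add: complex_ring_def)

lemma smult_complex_minus:
  assumes "x \<in> carrier A"
  shows "(- c) \<odot> x = \<ominus> (c \<odot> x)"
proof -
  have "(- c) \<odot> x \<oplus> c \<odot> x = \<zero>"
    using assms smult_complex_add[of x "- c" c] by simp
  then show ?thesis
    using assms minus_equality by simp
qed

lemma ordered_prod_Suc:
  assumes "\<And>i. f i \<in> carrier A"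
  shows "ordered_prod A f (Suc k) = ordered_prod A f k \<otimes> f k"
    and "ordered_prod A f k \<in> carrier A"
proof -
  \<comment> \<open>The fold exposes the first factor, whereas the recurrences append at the right
    end. Letting the seed \<open>x\<close> vary allows it to be pulled out as a last factor.\<close>
  have *: "foldr (\<otimes>) (map f is) x = foldr (\<otimes>) (map f is) \<one> \<otimes> x \<and>
      foldr (\<otimes>) (map f is) \<one> \<in> carrier A" if "x \<in> carrier A" for "is" x
    using that assms by (induction "is") (simp_all add: m_assoc)
  show "ordered_prod A f (Suc k) = ordered_prod A f k \<otimes> f k"
    using *[of "f k" "[0..<k]"] assms by (simp add: ordered_prod_def)
  show "ordered_prod A f k \<in> carrier A"
    using *[of \<one>] by (simp add: ordered_prod_def)
qed

text \<open>The extra \<open>V\<close> on the right avoids the exponent \<open>k - 1\<close>, so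
  that \<open>k = 0\<close> needs no special treatment. It is also the form met when
  \<open>T k\<close> is multiplied by \<open>U \<otimes> V\<close>.\<close>

lemma nat_pow_mult_commutation:
  assumes UV: "U \<in> carrier A" "V \<in> carrier A"
    and comm: "V \<otimes> U \<ominus> U \<otimes> V = a \<odot> V \<oplus> b \<odot> \<one>"
  shows "V [^] k \<otimes> U \<otimes> V =
    (U \<oplus> (of_nat k * a) \<odot> \<one>) \<otimes> V [^] Suc k \<oplus> (of_nat k * b) \<odot> V [^] k"
proof (induction k)
  case 0
  then show ?case using UV by simp
next
  case (Suc k)
  have "V \<otimes> U = (V \<otimes> U \<ominus> U \<otimes> V) \<oplus> U \<otimes> V"
    using UV by (simp add: minus_eq a_assoc l_neg)
  then have VU: "V \<otimes> U = (a \<odot> V \<oplus> b \<odot> \<one>) \<oplus> U \<otimes> V"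
    using comm by simp
  have "V [^] Suc k \<otimes> U \<otimes> V = V [^] k \<otimes> (V \<otimes> U) \<otimes> V"
    using UV by (simp add: m_assoc)
  \<comment> \<open>Only the innermost \<open>V\<close> is moved past \<open>U\<close>; the last
    summand is the induction hypothesis times \<open>V\<close>.\<close>
  also have "\<dots> = a \<odot> V [^] Suc (Suc k) \<oplus> b \<odot> V [^] Suc k \<oplus> (V [^] k \<otimes> U \<otimes> V) \<otimes> V"
    using UV by (simp add: VU m_assoc l_distr r_distr smult_mult_left smult_mult_right)
  also have "\<dots> = (U \<oplus> (of_nat (Suc k) * a) \<odot> \<one>) \<otimes> V [^] Suc (Suc k)
      \<oplus> (of_nat (Suc k) * b) \<odot> V [^] Suc k"
    unfolding Suc using UV
    by (simp add: m_assoc l_distr smult_mult_left smult_complex_add ring_distribs a_ac)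
  finally show ?case .
qed

text \<open>Starting the sum at \<open>k = 0\<close> lets the induction begin at
  \<open>n = 0\<close> and makes the index shifts uniform.\<close>

lemma nat_pow_UV_eq_finsum:
  assumes UV: "U \<in> carrier A" "V \<in> carrier A"
    and comm: "V \<otimes> U \<ominus> U \<otimes> V = a \<odot> V \<oplus> b \<odot> \<one>"
  shows "(U \<otimes> V) [^] n = (\<Oplus>k\<in>{..n}. (b ^ (n - k) * of_nat (Stirling n k)) \<odot>
    (ordered_prod A (\<lambda>i. U \<oplus> (of_nat i * a) \<odot> \<one>) k \<otimes> V [^] k))"
proof -
  define P where "P = ordered_prod A (\<lambda>i. U \<oplus> (of_nat i * a) \<odot> \<one>)"
  define T where "T k = P k \<otimes> V [^] k" for k :: nat
  have P [simp]: "P k \<in> carrier A" for k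
    unfolding P_def using UV by (intro ordered_prod_Suc) simp
  have P_Suc: "P (Suc k) = P k \<otimes> (U \<oplus> (of_nat k * a) \<odot> \<one>)" for k
    unfolding P_def using UV by (intro ordered_prod_Suc) simp
  have T [simp]: "T k \<in> carrier A" for k
    unfolding T_def using UV by simp
  have T_UV: "T k \<otimes> (U \<otimes> V) = T (Suc k) \<oplus> (of_nat k * b) \<odot> T k" for k
  proof -
    have "T k \<otimes> (U \<otimes> V) = P k \<otimes> (V [^] k \<otimes> U \<otimes> V)"
      using UV by (simp add: T_def m_assoc)
    also have "\<dots> = P (Suc k) \<otimes> V [^] Suc k \<oplus> (of_nat k * b) \<odot> T k"
      unfolding nat_pow_mult_commutation[OF UV comm] using UV
      by (simp add: T_def P_Suc m_assoc l_distr r_distr smult_mult_left smult_mult_right del: nat_pow_Suc)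
    finally show ?thesis by (simp add: T_def)
  qed
  have "(U \<otimes> V) [^] n = (\<Oplus>k\<in>{..n}. (b ^ (n - k) * of_nat (Stirling n k)) \<odot> T k)"
  proof (induction n)
    case 0
    then show ?case by (simp add: T_def P_def ordered_prod_def)
  next
    case (Suc n)
    define c where "c k = b ^ (n - k) * of_nat (Stirling n k)" for k
    define d where "d k = b ^ (Suc n - k) * of_nat (Stirling (Suc n) k)" for k
    \<comment> \<open>This is the Stirling recurrence weighted by powers of \<open>b\<close>. For
      \<open>k < n\<close> the exponents of \<open>c k\<close> and \<open>c (Suc k)\<close> differ
      by one, which the factor \<open>b\<close> makes up. For \<open>k = n\<close> the exponent in
      \<open>c (Suc n)\<close> is truncated, but \<open>Stirling n (Suc n) = 0\<close>.\<close>
    have d_Suc: "d (Suc k) = c k + (of_nat (Suc k) * b) * c (Suc k)" if "k \<le> n" for k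
    proof (cases "k = n")
      case False
      then have "Suc n - Suc k = Suc (n - Suc k)" "n - k = Suc (n - Suc k)"
        using that by auto
      then show ?thesis by (simp add: c_def d_def algebra_simps)
    qed (simp add: c_def d_def)
    have "(U \<otimes> V) [^] Suc n = (\<Oplus>k\<in>{..n}. c k \<odot> T k) \<otimes> (U \<otimes> V)"
      using Suc by (simp add: c_def)
    also have "\<dots> = (\<Oplus>k\<in>{..n}. c k \<odot> T k \<otimes> (U \<otimes> V))"
      using UV by (intro finsum_ldistr) auto
    also have "\<dots> = (\<Oplus>k\<in>{..n}. c k \<odot> T (Suc k) \<oplus> (of_nat k * b * c k) \<odot> T k)"
      using UV
      by (intro add.finprod_cong')
        (auto simp: smult_mult_left T_UV smult_complex_add_right mult.commute
          simp flip: smult_complex_mult)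
    also have "\<dots> = (\<Oplus>k\<in>{..n}. c k \<odot> T (Suc k)) \<oplus> (\<Oplus>k\<in>{..n}. (of_nat k * b * c k) \<odot> T k)"
      by (intro finsum_addf) auto
    \<comment> \<open>The added term is zero since \<open>c (Suc n) = 0\<close>. The term at
      \<open>k = 0\<close> is zero because of the factor \<open>of_nat k\<close>, so the index can
      then be shifted to match the other sum.\<close>
    also have "(\<Oplus>k\<in>{..n}. (of_nat k * b * c k) \<odot> T k) =
        (\<Oplus>k\<in>{..Suc n}. (of_nat k * b * c k) \<odot> T k)"
      by (subst finsum_Suc) (simp_all add: c_def)
    also have "\<dots> = (\<Oplus>k\<in>{..n}. (of_nat (Suc k) * b * c (Suc k)) \<odot> T (Suc k))"
      by (subst finsum_Suc2) (auto simp del: of_nat_Suc)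
    also have "(\<Oplus>k\<in>{..n}. c k \<odot> T (Suc k)) \<oplus> \<dots> =
        (\<Oplus>k\<in>{..n}. c k \<odot> T (Suc k) \<oplus> (of_nat (Suc k) * b * c (Suc k)) \<odot> T (Suc k))"
      by (intro finsum_addf[symmetric]) auto
    also have "\<dots> = (\<Oplus>k\<in>{..n}. d (Suc k) \<odot> T (Suc k))"
      by (intro add.finprod_cong')
        (auto simp: d_Suc simp flip: smult_complex_add simp del: of_nat_Suc)
    \<comment> \<open>The new term vanishes: \<open>d 0 = 0\<close> because
      \<open>Stirling (Suc n) 0 = 0\<close>.\<close>
    also have "\<dots> = (\<Oplus>k\<in>{..Suc n}. d k \<odot> T k)"
      by (subst finsum_Suc2) (auto simp: d_def)
    finally show ?case by (simp only: d_def)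
  qed
  then show ?thesis by (simp only: T_def P_def)
qed

end

text \<open>The factors agree one by one, as the sign of the step \<open>- a\<close> cancels the
  subtraction in \<open>gen_factorial\<close>.\<close>

lemma ordered_prod_eq_gen_factorial:
  fixes A :: "(complex, 'a) module" (structure)
  assumes "complex_algebra A" and U: "U \<in> carrier A"
  shows "ordered_prod A (\<lambda>i. U \<oplus> (of_nat i * a) \<odot> \<one>) k = gen_factorial A U (- a) k"
proof -
  interpret complex_algebra A by fact
  show ?thesis
  proof (induction k)
    case 0
    then show ?case by (simp add: ordered_prod_def)
  next
    case (Suc k)
    then show ?case
      using U by (simp add: ordered_prod_Suc smult_complex_minus minus_eq)
  qed
qed

theorem propositionA3:
  fixes A :: "(complex, 'a) module" (structure)
    and a b :: complex and U V :: 'a and n :: nat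
  assumes "complex_algebra A"
    and "U \<in> carrier A" and "V \<in> carrier A"
    and "V \<otimes> U \<ominus> U \<otimes> V = a \<odot> V \<oplus> b \<odot> \<one>"
    and "n \<ge> 1"
  shows "(U \<otimes> V) [^] n =
      (\<Oplus>k\<in>{1..n}. (b ^ (n - k) * of_nat (Stirling n k)) \<odot>
        (ordered_prod A (\<lambda>i. U \<oplus> (of_nat i * a) \<odot> \<one>) k \<otimes> V [^] k))
    \<and> (\<Oplus>k\<in>{1..n}. (b ^ (n - k) * of_nat (Stirling n k)) \<odot>
        (ordered_prod A (\<lambda>i. U \<oplus> (of_nat i * a) \<odot> \<one>) k \<otimes> V [^] k)) =
      (\<Oplus>k\<in>{1..n}. (b ^ (n - k) * of_nat (Stirling n k)) \<odot>
        (gen_factorial A U (- a) k \<otimes> V [^] k))"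
proof -
  interpret complex_algebra A by fact
  let ?f = "\<lambda>k. (b ^ (n - k) * of_nat (Stirling n k)) \<odot>
    (ordered_prod A (\<lambda>i. U \<oplus> (of_nat i * a) \<odot> \<one>) k \<otimes> V [^] k)"
  have f: "?f k \<in> carrier A" for k
    using assms by (intro smult_complex_closed m_closed ordered_prod_Suc) auto
  have "{..n} = insert 0 {1..n}" by auto
  \<comment> \<open>Here \<open>n \<ge> 1\<close> enters: \<open>Stirling n 0\<close> is zero for
    positive \<open>n\<close>, but \<open>Stirling 0 0 = 1\<close>.\<close>
  moreover have "?f 0 = \<zero>"
    using assms by (cases n) (auto simp: ordered_prod_def)
  ultimately have "(\<Oplus>k\<in>{..n}. ?f k) = (\<Oplus>k\<in>{1..n}. ?f k)"
    using f by (simp add: Pi_def)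
  then show ?thesis
    using nat_pow_UV_eq_finsum[OF assms(2-4), of n]
    by (simp only: ordered_prod_eq_gen_factorial[OF assms(1,2)] simp_thms)
qed

end
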